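(* Let $d,n$ be integers with $d\geq1$ and $n\geq1$. Then $\mathrm{gp}^2_d(P_n\,\Box\,P_2)=\lceil n/d\rceil$.
   Context: $P_n\,\Box\,P_2$ is the grid with vertex set $\{1,\ldots,n\}\times\{1,2\}$, where $(i,j)$ and $(i',j')$ are adjacent iff either $j=j'$ and $|i-i'|=1$, or $i=i'$ and $j\neq j'$. For a graph $G$, a geodesic is a shortest path between two vertices; its length $\lambda(g)$ is its number of edges. For $d\ge1$, $k\ge2$, $S\subseteq V(G)$ is a $k$-general $d$-position set if every geodesic $g$ with $|S\cap V(g)|\geq k$ has $\lambda(g)>d$; $\mathrm{gp}^k_d(G)$ is the largest cardinality of such a set. *)

theory Defs
  imports
    Complex_Main
    "Graph_Theory.Digraph"
    "Graph_Theory.Pair_Digraph"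
    "Graph_Theory.Vertex_Walk"
begin

text \<open>
  Undirected graphs are symmetric digraphs, as in the locale \<^locale>\<open>graph\<close>.
  Paths are lists of distinct vertices (\<^const>\<open>vpath\<close>), and
  \<^const>\<open>vwalk_length\<close> counts edges.  Single vertices are geodesics of length 0.
\<close>

definition geodesic :: "('a, 'b) pre_digraph \<Rightarrow> 'a vwalk \<Rightarrow> bool" where
  "geodesic G p \<longleftrightarrow> vpath p G \<and>
     (\<forall>q. vpath q G \<and> hd q = hd p \<and> last q = last p \<longrightarrow> vwalk_length p \<le> vwalk_length q)"

text \<open>The intended ranges of the parameters are \<open>k \<ge> 2\<close> and \<open>d \<ge> 1\<close>.\<close>

definition general_position_set :: "nat \<Rightarrow> nat \<Rightarrow> ('a, 'b) pre_digraph \<Rightarrow> 'a set \<Rightarrow> bool" where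
  "general_position_set k d G S \<longleftrightarrow> S \<subseteq> verts G \<and>
     (\<forall>g. geodesic G g \<and> card (S \<inter> set g) \<ge> k \<longrightarrow> vwalk_length g > d)"

text \<open>
  Only meaningful for finite \<open>G\<close>, where by the lemmas below the maximum is taken over a
  finite nonempty set.
\<close>

definition gp_number :: "nat \<Rightarrow> nat \<Rightarrow> ('a, 'b) pre_digraph \<Rightarrow> nat" where
  "gp_number k d G = Max {card S | S. general_position_set k d G S}"

lemma finite_general_position_cards:
  assumes "finite (verts G)"
  shows "finite {card S | S. general_position_set k d G S}"
proof -
  have "{card S | S. general_position_set k d G S} \<subseteq> card ` Pow (verts G)"
    by (auto simp: general_position_set_def)
  then show ?thesis
    using assms by (meson finite_Pow_iff finite_imageI finite_subset)
qed

lemma general_position_set_empty: "k > 0 \<Longrightarrow> general_position_set k d G {}"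
  by (auto simp: general_position_set_def)

definition grid2 :: "nat \<Rightarrow> (nat \<times> nat) pair_pre_digraph" where
  "grid2 n =
     (let V = {1..n} \<times> {1..2} in
      \<lparr> pverts = V,
        parcs = {((i, j), (i', j')) | i j i' j'. (i, j) \<in> V \<and> (i', j') \<in> V \<and>
          (j = j' \<and> \<bar>int i - int i'\<bar> = 1 \<or> i = i' \<and> j \<noteq> j')} \<rparr>)"

lemma pair_graph_grid2: "pair_graph (grid2 n)"
proof -
  have "parcs (grid2 n) \<subseteq> pverts (grid2 n) \<times> pverts (grid2 n)"
    and fin: "finite (pverts (grid2 n))"
    by (auto simp: grid2_def Let_def)
  then have fin': "finite (parcs (grid2 n))"
    by (meson finite_SigmaI finite_subset)
  show ?thesis
    by unfold_locales
      (use fin fin' in \<open>auto simp: grid2_def Let_def symmetric_def sym_def arcs_ends_def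
         arc_to_ends_def with_proj_def intro!: image_eqI\<close>)
qed

end

(* The graph distance on the grid is \<bar>i - i'\<bar> + [j \<noteq> j'], so a 2-general d-position set is exactly a set
   of vertices whose pairwise distances exceed d. A block of d consecutive columns has diameter at
   most d, hence contains at most one such vertex, which gives the upper bound. Taking one vertex in
   each of the columns 1, 1 + d, 1 + 2d, ..., in alternating rows, attains it: consecutive vertices
   are at distance d + 1, all others at distance at least 2d, and d < 2d. *)

theory Submission
  imports Defs
begin

text \<open>A closed formula, so that metric facts become arithmetic. That it is the graph distance
  follows from \<open>grid2_dist_le_vwalk_length\<close> (no walk is shorter) and
  \<open>grid2_vpath_of_length_dist\<close> (some path attains it).\<close>

definition grid2_dist :: "nat \<times> nat \<Rightarrow> nat \<times> nat \<Rightarrow> nat" where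
  "grid2_dist u v = nat \<bar>int (fst u) - int (fst v)\<bar> + of_bool (snd u \<noteq> snd v)"

lemma grid2_dist_commute: "grid2_dist u v = grid2_dist v u"
  by (auto simp: grid2_dist_def)

lemma grid2_dist_triangle: "grid2_dist u w \<le> grid2_dist u v + grid2_dist v w"
  by (auto simp: grid2_dist_def of_bool_def)

lemma grid2_dist_eq_0_iff [simp]: "grid2_dist u v = 0 \<longleftrightarrow> u = v"
  by (auto simp: grid2_dist_def prod_eq_iff of_bool_def)

lemma grid2_dist_self [simp]: "grid2_dist u u = 0"
  by simp

lemma pverts_grid2 [simp]: "pverts (grid2 n) = {1..n} \<times> {1..2}"
  by (simp add: grid2_def Let_def)

lemma parcs_grid2_iff:
  "(u, v) \<in> parcs (grid2 n) \<longleftrightarrow>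
     u \<in> {1..n} \<times> {1..2} \<and> v \<in> {1..n} \<times> {1..2} \<and> grid2_dist u v = 1"
  by (cases u; cases v) (auto simp: grid2_def Let_def grid2_dist_def of_bool_def)

text \<open>Each arc moves by distance 1, so the triangle inequality adds at most 1 per edge along
  the walk.\<close>

lemma grid2_dist_le_vwalk_length_hd:
  assumes "vwalk p (with_proj (grid2 n))" "x \<in> set p"
  shows "grid2_dist (hd p) x \<le> vwalk_length p"
  using assms
proof (induction p arbitrary: x rule: vwalk_induct)
  case (Cons u v es)
  have uv: "grid2_dist u v = 1"
    using Cons.hyps by (simp add: parcs_grid2_iff)
  show ?case
  proof (cases "x = u")
    case False
    then have "grid2_dist v x \<le> length es"
      using Cons by auto
    then show ?thesis
      using grid2_dist_triangle[of u x v] uv by simp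
  qed simp
qed simp

text \<open>Stated for arbitrary vertices of the walk, since a position set may meet a geodesic in
  interior vertices. Dropping the head until it is \<open>x\<close> or \<open>y\<close> reduces to
  the previous bound.\<close>

lemma grid2_dist_le_vwalk_length:
  assumes "vwalk p (with_proj (grid2 n))" "x \<in> set p" "y \<in> set p"
  shows "grid2_dist x y \<le> vwalk_length p"
  using assms
proof (induction p arbitrary: x y rule: list.induct)
  case (Cons u p)
  show ?case
  proof (cases "x = u \<or> y = u")
    case True
    then show ?thesis
      using grid2_dist_le_vwalk_length_hd[OF Cons.prems(1)] Cons.prems(2,3)
      by (metis grid2_dist_commute list.sel(1))
  next
    case False
    then have xy: "x \<in> set p" "y \<in> set p"
      using Cons.prems by auto
    then have "vwalk p (with_proj (grid2 n))"
      using Cons.prems(1) by (auto elim: vwalk_consE)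
    then have "grid2_dist x y \<le> vwalk_length p"
      using Cons.IH xy by blast
    then show ?thesis by simp
  qed
qed simp

text \<open>Move towards the column of \<open>v\<close> first and switch rows only once the columns
  agree.\<close>

lemma grid2_closer_neighbour:
  assumes "u \<in> {1..n} \<times> {1..2}" "v \<in> {1..n} \<times> {1..2}" "u \<noteq> v"
  obtains w where "(u, w) \<in> parcs (grid2 n)" "Suc (grid2_dist w v) = grid2_dist u v"
proof -
  obtain i j i' j' where ij: "u = (i, j)" "v = (i', j')"
    by (cases u, cases v)
  consider "i < i'" | "i' < i" | "i = i'" "j \<noteq> j'"
    using assms(3) ij by force
  then show ?thesis
  proof cases
    case 1
    then show ?thesis
      using assms ij by (intro that[of "(Suc i, j)"]) (auto simp: parcs_grid2_iff grid2_dist_def)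
  next
    case 2
    then show ?thesis
      \<comment> \<open>Here \<open>i - 1\<close> is at least \<open>i'\<close>, hence at least 1:
        the subtraction is not truncated and the vertex stays in the grid.\<close>
      using assms ij by (intro that[of "(i - 1, j)"]) (auto simp: parcs_grid2_iff grid2_dist_def)
  next
    case 3
    then show ?thesis
      using assms ij by (intro that[of "(i, j')"]) (auto simp: parcs_grid2_iff grid2_dist_def)
  qed
qed

text \<open>Greedy descent: repeatedly pass to a closer neighbour. The last conjunct strengthens the
  induction so that the walk obtained has no repeated vertex.\<close>

lemma grid2_vpath_of_length_dist:
  assumes "u \<in> {1..n} \<times> {1..2}" "v \<in> {1..n} \<times> {1..2}"
  shows "\<exists>p. vpath p (with_proj (grid2 n)) \<and> hd p = u \<and> last p = v \<and>
           vwalk_length p = grid2_dist u v \<and> (\<forall>x\<in>set p. grid2_dist x v \<le> grid2_dist u v)"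
  using assms(1)
proof (induction "grid2_dist u v" arbitrary: u)
  case 0
  then have "u = v"
    using grid2_dist_eq_0_iff by metis
  then show ?case
    using 0 by (intro exI[of _ "[u]"]) (auto simp: vpath_def simp del: mem_Sigma_iff)
next
  case (Suc k)
  then have "u \<noteq> v"
    by auto
  then obtain w where w: "(u, w) \<in> parcs (grid2 n)" "Suc (grid2_dist w v) = grid2_dist u v"
    using grid2_closer_neighbour Suc.prems assms(2) by blast
  then have "w \<in> {1..n} \<times> {1..2}" "k = grid2_dist w v"
    using Suc.hyps(2) by (auto simp: parcs_grid2_iff)
  then obtain p where p: "vpath p (with_proj (grid2 n))" "hd p = w" "last p = v"
      "vwalk_length p = grid2_dist w v" "\<forall>x\<in>set p. grid2_dist x v \<le> grid2_dist w v"
    using Suc.hyps(1) by blast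
  have "p \<noteq> []"
    using p(1) by (auto simp: vpath_def vwalk_def)
  \<comment> \<open>All vertices of \<open>p\<close> are at most as far from \<open>v\<close> as
    \<open>w\<close> is, and \<open>u\<close> is strictly farther.\<close>
  have "u \<notin> set p"
    using p(5) w(2) by fastforce
  moreover have "vwalk (u # p) (with_proj (grid2 n))"
    using p(1,2) w(1) Suc.prems by (intro vwalk_consI) (auto simp: vpath_def)
  ultimately have "vpath (u # p) (with_proj (grid2 n))"
    using p(1) by (auto simp: vpath_def)
  moreover have "length p = Suc (grid2_dist w v)"
    using p(4) \<open>p \<noteq> []\<close> by (cases p) auto
  ultimately show ?case
    using p w(2) \<open>p \<noteq> []\<close> by (intro exI[of _ "u # p"]) fastforce
qed

lemma grid2_geodesic_exists:
  assumes "u \<in> {1..n} \<times> {1..2}" "v \<in> {1..n} \<times> {1..2}"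
  obtains p where "geodesic (with_proj (grid2 n)) p" "u \<in> set p" "v \<in> set p"
    "vwalk_length p = grid2_dist u v"
proof -
  obtain p where p: "vpath p (with_proj (grid2 n))" "hd p = u" "last p = v"
      "vwalk_length p = grid2_dist u v"
    using grid2_vpath_of_length_dist[OF assms] by blast
  have ends: "hd q \<in> set q" "last q \<in> set q" if "vpath q (with_proj (grid2 n))" for q
    using that by (auto simp: vpath_def vwalk_def)
  have "vwalk_length p \<le> vwalk_length q"
    if "vpath q (with_proj (grid2 n))" "hd q = u" "last q = v" for q
    using that p(4) ends[of q] grid2_dist_le_vwalk_length[of q n u v] by (auto simp: vpath_def)
  then have "geodesic (with_proj (grid2 n)) p"
    using p unfolding geodesic_def by blast
  then show ?thesis
    using that p ends[of p] by blast
qed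

text \<open>Removes geodesics from the problem. Two points of \<open>S\<close> lie on a geodesic as
  long as their distance; conversely, a geodesic through two points of \<open>S\<close> is at least
  as long as their distance.\<close>

lemma general_position_set_grid2_iff:
  "general_position_set 2 d (with_proj (grid2 n)) S \<longleftrightarrow>
     S \<subseteq> {1..n} \<times> {1..2} \<and> (\<forall>x\<in>S. \<forall>y\<in>S. x \<noteq> y \<longrightarrow> d < grid2_dist x y)"
    (is "?L \<longleftrightarrow> ?R")
proof
  assume L: ?L
  then have S: "S \<subseteq> {1..n} \<times> {1..2}"
    by (simp add: general_position_set_def)
  have "d < grid2_dist x y" if xy: "x \<in> S" "y \<in> S" "x \<noteq> y" for x y
  proof -
    obtain p where p: "geodesic (with_proj (grid2 n)) p" "x \<in> set p" "y \<in> set p"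
        "vwalk_length p = grid2_dist x y"
      by (rule grid2_geodesic_exists[of x n y]) (use xy S in auto)
    have "card {x, y} \<le> card (S \<inter> set p)"
      using xy p(2,3) by (intro card_mono) auto
    then have "2 \<le> card (S \<inter> set p)"
      using xy(3) by simp
    then show ?thesis
      using L p(1,4) unfolding general_position_set_def by metis
  qed
  then show ?R
    using S by blast
next
  assume R: ?R
  have "d < vwalk_length p"
    if p: "geodesic (with_proj (grid2 n)) p" "2 \<le> card (S \<inter> set p)" for p
  proof -
    obtain x y where xy: "x \<in> S \<inter> set p" "y \<in> S \<inter> set p" "x \<noteq> y"
      using p(2)
      by (metis card_le_Suc0_iff_eq finite_Int List.finite_set not_less_eq_eq numeral_2_eq_2)
    then have "d < grid2_dist x y"
      using R by blast
    also have "\<dots> \<le> vwalk_length p"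
      using p(1) xy by (intro grid2_dist_le_vwalk_length) (auto simp: geodesic_def vpath_def)
    finally show ?thesis .
  qed
  then show ?L
    using R by (auto simp: general_position_set_def)
qed

lemma same_block_diff_less:
  fixes a b d :: nat
  assumes "a div d = b div d" "d \<ge> 1"
  shows "\<bar>int a - int b\<bar> < int d"
proof -
  have "int a - int b = int (a mod d) - int (b mod d)"
    using assms(1) div_mult_mod_eq[of a d] div_mult_mod_eq[of b d]
    by (metis add_diff_cancel_left of_nat_add)
  moreover have "a mod d < d" "b mod d < d"
    using assms(2) by auto
  ultimately show ?thesis
    by linarith
qed

lemma card_general_position_set_grid2_le:
  assumes "general_position_set 2 d (with_proj (grid2 n)) S" "d \<ge> 1"
  shows "card S \<le> Suc ((n - 1) div d)"
proof -
  have S: "S \<subseteq> {1..n} \<times> {1..2}" and dist: "\<And>x y. x \<in> S \<Longrightarrow> y \<in> S \<Longrightarrow> x \<noteq> y \<Longrightarrow> d < grid2_dist x y"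
    using assms(1) by (auto simp: general_position_set_grid2_iff)
  \<comment> \<open>Columns start at 1, so the shift makes the blocks \<open>1..d\<close>,
    \<open>d+1..2d\<close>, and so on; the last one may be incomplete.\<close>
  let ?block = "\<lambda>x. (fst x - 1) div d"
  have "inj_on ?block S"
  proof (rule inj_onI, rule ccontr)
    fix x y assume xy: "x \<in> S" "y \<in> S" "?block x = ?block y" "x \<noteq> y"
    then have "\<bar>int (fst x - 1) - int (fst y - 1)\<bar> < int d"
      using same_block_diff_less assms(2) by blast
    moreover have "fst x \<ge> 1" "fst y \<ge> 1"
      using S xy by auto
    \<comment> \<open>Fewer than \<open>d\<close> columns apart, plus at most 1 for the row.\<close>
    ultimately have "grid2_dist x y \<le> d"
      by (auto simp: grid2_dist_def of_bool_def)
    then show False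
      using dist[OF xy(1,2,4)] by simp
  qed
  moreover have "?block ` S \<subseteq> {..(n - 1) div d}"
    using S by (fastforce intro!: div_le_mono diff_le_mono)
  ultimately have "card S \<le> card {..(n - 1) div d}"
    by (intro card_inj_on_le) auto
  then show ?thesis
    by simp
qed

lemma exists_general_position_set_grid2:
  assumes "d \<ge> 1" "n \<ge> 1"
  shows "\<exists>S. general_position_set 2 d (with_proj (grid2 n)) S \<and> card S = Suc ((n - 1) div d)"
proof -
  \<comment> \<open>The range of \<open>k\<close> used below stops at the largest \<open>k\<close>
    with \<open>1 + k * d \<le> n\<close>; the parity of \<open>k\<close> selects the row.\<close>
  let ?f = "\<lambda>k. (1 + k * d, 1 + k mod 2)"
  let ?S = "?f ` {..(n - 1) div d}"
  have inj: "inj_on ?f {..(n - 1) div d}"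
    using assms(1) by (auto intro: inj_onI)
  have less: "d < grid2_dist (?f k) (?f l)" if "k < l" for k l
  proof (cases "l = Suc k")
    case True
    have "k mod 2 \<noteq> l mod 2"
      using True by presburger
    then show ?thesis
      using True by (simp add: grid2_dist_def)
  next
    case False
    \<comment> \<open>Now \<open>l\<close> is at least \<open>k + 2\<close>, so the columns alone
      give distance \<open>2 * d\<close>, whatever the rows are.\<close>
    then have "(k + 2) * d \<le> l * d"
      using that by (intro mult_right_mono) auto
    then have "int k * int d + 2 * int d \<le> int l * int d"
      by (metis add_mult_distrib of_nat_add of_nat_le_iff of_nat_mult of_nat_numeral)
    then show ?thesis
      using assms(1) by (simp add: grid2_dist_def)
  qed
  have "k * d \<le> n - 1" if "k \<le> (n - 1) div d" for k
    using that assms(1) by (simp add: less_eq_div_iff_mult_less_eq)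
  then have "?S \<subseteq> {1..n} \<times> {1..2}"
    using assms(2) by fastforce
  moreover have "d < grid2_dist (?f k) (?f l)" if "k \<noteq> l" for k l
    using that less[of k l] less[of l k] by (metis grid2_dist_commute linorder_neqE_nat)
  ultimately have "general_position_set 2 d (with_proj (grid2 n)) ?S"
    unfolding general_position_set_grid2_iff by (metis (no_types, lifting) imageE)
  moreover have "card ?S = Suc ((n - 1) div d)"
    using inj by (simp add: card_image)
  ultimately show ?thesis
    by blast
qed

text \<open>With \<open>q = (n - 1) div d\<close>, division with remainder gives
  \<open>q * d < n \<le> (q + 1) * d\<close>, which characterises the ceiling as
  \<open>q + 1\<close>.\<close>

lemma ceiling_divide_nat:
  fixes d n :: nat
  assumes "d \<ge> 1" "n \<ge> 1"
  shows "\<lceil>real n / real d\<rceil> = int (Suc ((n - 1) div d))"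
proof (rule ceiling_unique)
  have "(n - 1) div d * d \<le> n - 1"
    by simp
  \<comment> \<open>Strictness comes from \<open>n \<ge> 1\<close>, which makes \<open>n - 1\<close>
    smaller than \<open>n\<close>.\<close>
  then have "(n - 1) div d * d < n"
    using assms(2) by linarith
  then have "real ((n - 1) div d) * real d < real n"
    by (metis of_nat_less_iff of_nat_mult)
  then show "of_int (int (Suc ((n - 1) div d))) - 1 < real n / real d"
    using assms(1) by (simp add: field_simps)
  have "n - 1 < Suc ((n - 1) div d) * d"
    using assms(1) dividend_less_div_times[of d "n - 1"] by simp
  then have "n \<le> Suc ((n - 1) div d) * d"
    by linarith
  then have "real n \<le> real (Suc ((n - 1) div d)) * real d"
    by (metis of_nat_le_iff of_nat_mult)
  then show "real n / real d \<le> of_int (int (Suc ((n - 1) div d)))"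
    using assms(1) by (simp add: field_simps)
qed

theorem theorem6p3:
  fixes d n :: nat
  assumes "d \<ge> 1" and "n \<ge> 1"
  shows "int (gp_number 2 d (with_proj (grid2 n))) = \<lceil>real n / real d\<rceil>"
proof -
  have "gp_number 2 d (with_proj (grid2 n)) = Suc ((n - 1) div d)"
    unfolding gp_number_def
  proof (rule Max_eqI)
    show "finite {card S | S. general_position_set 2 d (with_proj (grid2 n)) S}"
      by (rule finite_general_position_cards) simp
    show "Suc ((n - 1) div d) \<in> {card S | S. general_position_set 2 d (with_proj (grid2 n)) S}"
      using exists_general_position_set_grid2[OF assms] unfolding mem_Collect_eq by metis
  qed (use card_general_position_set_grid2_le assms(1) in blast)
  then show ?thesis
    using ceiling_divide_nat[OF assms] by simp
qed

end
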